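(* Let $[a,b]=[0,\frac7{15}]$ and $[c,d]=[\frac8{15},1]$, let $p=\frac{51}{500}$, and let $P=pP_1+(1-p)P_2$ be the mixed distribution generated by the uniform distributions $P_1$ on $[a,b]$ and $P_2$ on $[c,d]$. Then an optimal set $\alpha_2$ of two-means for $P$ contains an element from the open interval $(b,c)=(\frac7{15},\frac8{15})$.
   Context: For a Borel probability measure $P$ on $\mathbb{R}$ and $n\in\mathbb{N}$, the $n$th quantization error is $V_n=V_n(P)=\inf\{\int\min_{a\in\alpha}(x-a)^2\,dP(x) : \alpha\subset\mathbb{R},\ 1\le\mathrm{card}(\alpha)\le n\}$, and an optimal set of $n$-means for $P$ is a set $\alpha$ with $1\le\mathrm{card}(\alpha)\le n$ attaining this infimum. *)

theory Defs
  imports "HOL-Probability.Probability"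
begin

definition mixture_measure :: "real \<Rightarrow> 'a measure \<Rightarrow> 'a measure \<Rightarrow> 'a measure" where
  "mixture_measure p M N =
     measure_of (space M) (sets M)
       (\<lambda>A. ennreal p * emeasure M A + ennreal (1 - p) * emeasure N A)"

lemma space_mixture_measure [simp]: "space (mixture_measure p M N) = space M"
  by (simp add: mixture_measure_def)

lemma sets_mixture_measure [simp, measurable_cong]: "sets (mixture_measure p M N) = sets M"
  by (simp add: mixture_measure_def)

lemma emeasure_mixture_measure:
  assumes "sets N = sets M" and A: "A \<in> sets M"
  shows "emeasure (mixture_measure p M N) A =
           ennreal p * emeasure M A + ennreal (1 - p) * emeasure N A"
  unfolding mixture_measure_def
proof (rule emeasure_measure_of_sigma[OF _ _ _ A])
  show "sigma_algebra (space M) (sets M)" ..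
  show "positive (sets M) (\<lambda>A. ennreal p * emeasure M A + ennreal (1 - p) * emeasure N A)"
    by (simp add: positive_def)
  show "countably_additive (sets M)
          (\<lambda>A. ennreal p * emeasure M A + ennreal (1 - p) * emeasure N A)"
    unfolding countably_additive_def
    by (auto simp: suminf_add[symmetric] suminf_emeasure ennreal_suminf_cmult assms(1))
qed

lemma prob_space_mixture_measure:
  assumes "prob_space M" "prob_space N" "sets N = sets M" "0 \<le> p" "p \<le> 1"
  shows "prob_space (mixture_measure p M N)"
proof (rule prob_spaceI)
  have "emeasure N (space M) = 1"
    using prob_space.emeasure_space_1[OF assms(2)] sets_eq_imp_space_eq[OF assms(3)] by simp
  with assms show "emeasure (mixture_measure p M N) (space (mixture_measure p M N)) = 1"
    by (simp add: emeasure_mixture_measure prob_space.emeasure_space_1 flip: ennreal_plus)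
qed

text \<open>
  The integrals are taken in the extended nonnegative reals, so that a distribution with
  infinite second moment has infinite error instead of the default value 0 of the Bochner
  integral. The condition \<^term>\<open>1 \<le> card \<alpha>\<close> also ensures that
  \<^term>\<open>\<alpha>\<close> is finite, so the minimum is a genuine one.
\<close>

definition distortion :: "real measure \<Rightarrow> real set \<Rightarrow> ennreal" where
  "distortion P \<alpha> = (\<integral>\<^sup>+ x. ennreal (MIN a\<in>\<alpha>. (x - a)\<^sup>2) \<partial>P)"

definition quantization_error :: "nat \<Rightarrow> real measure \<Rightarrow> ennreal" where
  "quantization_error n P = (INF \<alpha>\<in>{\<alpha>. 1 \<le> card \<alpha> \<and> card \<alpha> \<le> n}. distortion P \<alpha>)"

definition optimal_n_means :: "nat \<Rightarrow> real measure \<Rightarrow> real set \<Rightarrow> bool" where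
  "optimal_n_means n P \<alpha> \<longleftrightarrow>
     1 \<le> card \<alpha> \<and> card \<alpha> \<le> n \<and> distortion P \<alpha> = quantization_error n P"

end

theory Submission
  imports Defs
begin

text \<open>
  Write \<open>L = 7/15\<close> for the common length of the two supports. A competitor with both points
  off the gap is compared with the explicit pair \<open>{49/100, 83/100}\<close>, whose cost is
  about \<open>0.017972\<close>. The pair of midpoints of the two supports costs \<open>L\<^sup>2/12\<close>, about
  \<open>0.018148\<close>, and with \<open>7/15\<close> as left point a cost of about \<open>0.018026\<close> is possible. The
  margin is thus below one percent, and the estimates have to be nearly sharp.

  Two facts about the uniform distribution on one interval suffice. If the left point \<open>u\<close>
  is prescribed, the second point does best when the piece from \<open>u\<close> to the right end is cut
  into three equal parts, with the cell boundary after the first part; this gives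
  \<open>integral_sq_dist2_ge_cubic\<close>, a lower bound that depends only on \<open>u\<close>. When \<open>u\<close> lies half
  an interval length or more outside the interval, this optimal boundary is no longer interior, so
  \<open>u\<close> does not help at all and the bound is the one-point error
  (\<open>integral_sq_dist2_ge_remote_left\<close>, \<open>integral_sq_dist2_ge_remote_right\<close>).

  For two points \<open>u \<le> v\<close>, every \<open>x\<close> in the left support is closer to \<open>u\<close> when
  the midpoint of \<open>u\<close> and \<open>v\<close> lies to the right of that support; otherwise every
  \<open>x\<close> in the right support is closer to \<open>v\<close>. In the second situation, either \<open>v\<close> is remote from the
  left support and the cost is at least \<open>L\<^sup>2/12\<close>, or \<open>v\<close> is so far from the midpoint of
  the heavy right support that the cost is too large. In the first situation a remote \<open>u\<close>
  again gives at least \<open>L\<^sup>2/12\<close>, and for the other \<open>u\<close> up to \<open>1\<close> the cost is bounded below by a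
  cubic in \<open>u\<close> that equals the cost of the explicit pair at \<open>u = 49/100\<close> and exceeds it at every
  \<open>u \<ge> 3/10\<close> off the gap (\<open>cubic_bound_off_gap\<close>). A \<open>u\<close> beyond \<open>1\<close> is too far from the left
  support.
\<close>

section \<open>Integration against mixtures of uniform distributions\<close>

lemma nn_integral_mixture_measure:
  assumes N: "sets N = sets M" and f: "f \<in> borel_measurable M"
  shows "(\<integral>\<^sup>+x. f x \<partial>mixture_measure p M N) =
           ennreal p * (\<integral>\<^sup>+x. f x \<partial>M) + ennreal (1 - p) * (\<integral>\<^sup>+x. f x \<partial>N)"
  using f
proof induct
  case (cong f g)
  have "space N = space M"
    using N by (rule sets_eq_imp_space_eq)
  with cong(3) have "integral\<^sup>N (mixture_measure p M N) f = integral\<^sup>N (mixture_measure p M N) g"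
    "integral\<^sup>N M f = integral\<^sup>N M g" "integral\<^sup>N N f = integral\<^sup>N N g"
    by (auto intro!: nn_integral_cong)
  with cong(4) show ?case
    by simp
next
  case (set A)
  then show ?case
    using N by (simp add: emeasure_mixture_measure)
next
  case (mult u c)
  note [measurable_cong] = N
  note [measurable] = mult(2)
  show ?case
    by (simp add: nn_integral_cmult mult(4) distrib_left mult.left_commute)
next
  case (add u v)
  note [measurable_cong] = N
  note [measurable] = add(1,4)
  show ?case
    by (simp add: nn_integral_add add distrib_left ac_simps)
next
  case (seq U)
  note [measurable_cong] = N
  note [measurable] = seq(1)
  have inc: "incseq (\<lambda>i. ennreal r * integral\<^sup>N K (U i))" for r K
    using seq(4)
    by (auto simp: incseq_def le_fun_def intro!: mult_left_mono nn_integral_mono)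
  have "(SUP i. integral\<^sup>N (mixture_measure p M N) (U i)) =
      (SUP i. ennreal p * integral\<^sup>N M (U i)) + (SUP i. ennreal (1 - p) * integral\<^sup>N N (U i))"
    by (simp add: seq(3) ennreal_SUP_add[OF inc inc])
  then show ?case
    using seq(4) unfolding SUP_apply[abs_def] image_comp
    by (simp add: nn_integral_monotone_convergence_SUP SUP_mult_left_ennreal)
qed

lemma nn_integral_uniform_measure_Icc:
  fixes f :: "real \<Rightarrow> real"
  assumes "s < e" and f: "continuous_on UNIV f" and nonneg: "\<And>x. 0 \<le> f x"
  shows "(\<integral>\<^sup>+x. ennreal (f x) \<partial>uniform_measure lborel {s..e}) = ennreal (integral {s..e} f / (e - s))"
proof -
  have [measurable]: "f \<in> borel_measurable borel"
    using f by (rule borel_measurable_continuous_onI)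
  have int: "f integrable_on {s..e}"
    using f by (intro integrable_continuous_interval) (rule continuous_on_subset, auto)
  have "(\<integral>\<^sup>+x. ennreal (f x) * indicator {s..e} x \<partial>lborel) = ennreal (integral {s..e} f)"
    using nonneg int by (intro nn_integral_has_integral_lebesgue') (auto simp: integrable_integral)
  moreover have "0 \<le> integral {s..e} f"
    using int nonneg by (rule Henstock_Kurzweil_Integration.integral_nonneg)
  ultimately show ?thesis
    using \<open>s < e\<close> by (simp add: nn_integral_uniform_measure divide_ennreal)
qed

definition sq_dist2 :: "real \<Rightarrow> real \<Rightarrow> real \<Rightarrow> real" where
  "sq_dist2 u v x = min ((x - u)\<^sup>2) ((x - v)\<^sup>2)"

lemma sq_dist2_nonneg: "0 \<le> sq_dist2 u v x"
  by (simp add: sq_dist2_def)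

lemma continuous_on_sq_dist2: "continuous_on S (sq_dist2 u v)"
  unfolding sq_dist2_def by (intro continuous_intros)

lemma sq_dist2_integrable: "sq_dist2 u v integrable_on {s..e}"
  by (intro integrable_continuous_interval continuous_on_sq_dist2)

lemma distortion_pair:
  assumes "s < e" "s' < e'" "0 \<le> p" "p \<le> 1"
  shows "distortion (mixture_measure p (uniform_measure lborel {s..e}) (uniform_measure lborel {s'..e'})) {u, v} =
    ennreal (p * (integral {s..e} (sq_dist2 u v) / (e - s)) +
      (1 - p) * (integral {s'..e'} (sq_dist2 u v) / (e' - s')))"
proof -
  have [measurable]: "sq_dist2 u v \<in> borel_measurable borel"
    by (intro borel_measurable_continuous_onI continuous_on_sq_dist2)
  have min_eq: "(MIN a\<in>{u, v}. (x - a)\<^sup>2) = sq_dist2 u v x" for x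
    by (simp add: sq_dist2_def)
  have "0 \<le> integral {l..r} (sq_dist2 u v)" for l r
    by (intro Henstock_Kurzweil_Integration.integral_nonneg sq_dist2_integrable sq_dist2_nonneg)
  then show ?thesis
    unfolding distortion_def min_eq using assms
    by (simp add: nn_integral_mixture_measure nn_integral_uniform_measure_Icc
        continuous_on_sq_dist2 sq_dist2_nonneg ennreal_mult' ennreal_plus flip: ennreal_mult')
qed

section \<open>Lower bounds for the two-point error on one interval\<close>

lemma integral_sq_dist:
  fixes s e u :: real
  assumes "s \<le> e"
  shows "integral {s..e} (\<lambda>x. (x - u)\<^sup>2) = ((e - u) ^ 3 - (s - u) ^ 3) / 3"
proof -
  have "((\<lambda>x. (x - u)\<^sup>2) has_integral (e - u) ^ 3 / 3 - (s - u) ^ 3 / 3) {s..e}"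
    by (intro fundamental_theorem_of_calculus assms)
      (auto simp flip: has_real_derivative_iff_has_vector_derivative intro!: derivative_eq_intros)
  then show ?thesis
    by (simp add: integral_unique diff_divide_distrib)
qed

lemma integral_sq_dist_variance:
  fixes s e u :: real
  assumes "s \<le> e"
  shows "integral {s..e} (\<lambda>x. (x - u)\<^sup>2) = (e - s) ^ 3 / 12 + (e - s) * ((s + e) / 2 - u)\<^sup>2"
  unfolding integral_sq_dist[OF assms] by (simp add: field_simps power2_eq_square power3_eq_cube)

lemma sq_dist2_eq_left:
  assumes "u \<le> v" "x \<le> (u + v) / 2"
  shows "sq_dist2 u v x = (x - u)\<^sup>2"
proof -
  have "0 \<le> (v - u) * (u + v - 2 * x)"
    using assms by (intro mult_nonneg_nonneg) auto
  also have "\<dots> = (x - v)\<^sup>2 - (x - u)\<^sup>2"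
    by (simp add: algebra_simps power2_eq_square)
  finally show ?thesis
    by (simp add: sq_dist2_def)
qed

lemma sq_dist2_reflect: "sq_dist2 (- u) (- v) (- x) = sq_dist2 u v x"
  by (simp add: sq_dist2_def power2_commute)

lemma sq_dist2_commute: "sq_dist2 u v = sq_dist2 v u"
  by (simp add: sq_dist2_def fun_eq_iff min.commute)

lemma sq_dist2_eq_right:
  assumes "u \<le> v" "(u + v) / 2 \<le> x"
  shows "sq_dist2 u v x = (x - v)\<^sup>2"
  using sq_dist2_eq_left[of "- v" "- u" "- x"] assms
  by (simp add: sq_dist2_reflect sq_dist2_commute[of v u] power2_commute)

lemma integral_sq_dist2_left:
  assumes "u \<le> v" "e \<le> (u + v) / 2"
  shows "integral {s..e} (sq_dist2 u v) = integral {s..e} (\<lambda>x. (x - u)\<^sup>2)"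
  using assms by (intro integral_cong) (auto intro!: sq_dist2_eq_left)

lemma integral_sq_dist2_right:
  assumes "u \<le> v" "(u + v) / 2 \<le> s"
  shows "integral {s..e} (sq_dist2 u v) = integral {s..e} (\<lambda>x. (x - v)\<^sup>2)"
  using assms by (intro integral_cong) (auto intro!: sq_dist2_eq_right)

lemma integral_sq_dist2_split:
  assumes "s \<le> m" "m \<le> e"
  shows "integral {s..e} (sq_dist2 u v) = integral {s..m} (sq_dist2 u v) + integral {m..e} (sq_dist2 u v)"
  using assms by (intro Henstock_Kurzweil_Integration.integral_combine[symmetric] sq_dist2_integrable)

text \<open>
  Let \<open>h\<close> be the distance from \<open>u\<close> to the cell boundary and \<open>w = e - v\<close>, so that
  \<open>e - u = 2 h + w\<close> and the error is \<open>(2 h\<^sup>3 + w\<^sup>3)/3\<close>. It is minimal for \<open>h = w\<close>, and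
  the excess over the minimum is a multiple of \<open>(h - w)\<^sup>2\<close>.
\<close>

lemma integral_sq_dist2_ge_from_left_point:
  assumes "u \<le> v" "u \<le> e"
  shows "(e - u) ^ 3 / 27 \<le> integral {u..e} (sq_dist2 u v)"
proof (cases "(u + v) / 2 \<le> e")
  case True
  define h where "h = (v - u) / 2"
  define w where "w = e - v"
  have vh: "v = u + 2 * h" and e: "e = u + 2 * h + w"
    by (simp_all add: h_def w_def field_simps)
  have "0 \<le> h" "- h \<le> w"
    using assms True unfolding h_def w_def by (simp_all add: field_simps)
  then have "0 \<le> (h - w)\<^sup>2 * (10 * h + 8 * w) / 27"
    by simp
  also have "\<dots> = (2 * h ^ 3 + w ^ 3) / 3 - (2 * h + w) ^ 3 / 27"
    by (simp add: field_simps power2_eq_square power3_eq_cube)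
  finally have "(2 * h + w) ^ 3 / 27 \<le> (2 * h ^ 3 + w ^ 3) / 3"
    by simp
  moreover have "integral {u..e} (sq_dist2 u v) = (2 * h ^ 3 + w ^ 3) / 3"
  proof -
    have "integral {u..e} (sq_dist2 u v) =
        integral {u..u + h} (sq_dist2 u v) + integral {u + h..e} (sq_dist2 u v)"
      using assms True \<open>0 \<le> h\<close> unfolding vh by (intro integral_sq_dist2_split) auto
    also have "\<dots> = (h ^ 3 + (w ^ 3 - (- h) ^ 3)) / 3"
      using \<open>0 \<le> h\<close> \<open>- h \<le> w\<close> unfolding vh e
      by (simp add: integral_sq_dist2_left integral_sq_dist2_right integral_sq_dist add_divide_distrib)
    finally show ?thesis
      by simp
  qed
  moreover have "e - u = 2 * h + w"
    by (simp add: e)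
  ultimately show ?thesis
    by simp
next
  case False
  have "(e - u) ^ 3 / 27 \<le> (e - u) ^ 3 / 3"
    using assms by (intro divide_left_mono) auto
  also have "\<dots> = integral {u..e} (sq_dist2 u v)"
    using assms False by (simp add: integral_sq_dist2_left integral_sq_dist)
  finally show ?thesis .
qed

text \<open>
  Between \<open>s\<close> and \<open>u\<close> the error is at most that of \<open>u\<close> alone, with equality if
  \<open>s \<le> u\<close>; the sign of \<open>(s - u)\<^sup>3\<close> accounts for removing or adding this piece, so one formula
  serves for both positions of \<open>u\<close>.
\<close>

lemma integral_sq_dist2_ge_cubic:
  assumes "u \<le> v" "u \<le> e" "s \<le> e"
  shows "(e - u) ^ 3 / 27 - (s - u) ^ 3 / 3 \<le> integral {s..e} (sq_dist2 u v)"
proof (cases "u \<le> s")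
  case True
  have "integral {u..s} (sq_dist2 u v) \<le> integral {u..s} (\<lambda>x. (x - u)\<^sup>2)"
    by (intro integral_le sq_dist2_integrable integrable_continuous_interval continuous_intros)
      (simp add: sq_dist2_def)
  also have "\<dots> = (s - u) ^ 3 / 3"
    using True by (simp add: integral_sq_dist)
  finally show ?thesis
    using integral_sq_dist2_ge_from_left_point[OF assms(1,2)]
      integral_sq_dist2_split[of u s e u v] True assms by simp
next
  case False
  then have "integral {s..u} (sq_dist2 u v) = - ((s - u) ^ 3) / 3"
    using assms by (simp add: integral_sq_dist2_left integral_sq_dist)
  then show ?thesis
    using integral_sq_dist2_ge_from_left_point[OF assms(1,2)]
      integral_sq_dist2_split[of s u e u v] False assms by simp
qed

text \<open>
  At \<open>u = s - (e - s)/2\<close> the cubic bound equals the one-point error \<open>(e - s)\<^sup>3/12\<close>. Moving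
  either point rightwards up to this threshold does not increase the distances to the interval, and
  puts the points in the order that the cubic bound needs.
\<close>

lemma integral_sq_dist2_ge_remote_left:
  assumes "s \<le> e" "u \<le> s - (e - s) / 2"
  shows "(e - s) ^ 3 / 12 \<le> integral {s..e} (sq_dist2 u v)"
proof -
  define t where "t = s - (e - s) / 2"
  have t: "u \<le> t" "t \<le> s"
    using assms by (auto simp: t_def)
  have "sq_dist2 t (max v t) x \<le> sq_dist2 u v x" if "x \<in> {s..e}" for x
  proof -
    have closer: "(x - t)\<^sup>2 \<le> (x - y)\<^sup>2" if "y \<le> t" for y
      using that t \<open>x \<in> {s..e}\<close> by (intro power_mono) auto
    then show ?thesis
      using t by (auto simp: sq_dist2_def max_def min_le_iff_disj)
  qed
  then have "integral {s..e} (sq_dist2 t (max v t)) \<le> integral {s..e} (sq_dist2 u v)"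
    by (intro integral_le sq_dist2_integrable)
  moreover have "(e - t) ^ 3 / 27 - (s - t) ^ 3 / 3 \<le> integral {s..e} (sq_dist2 t (max v t))"
    using assms t by (intro integral_sq_dist2_ge_cubic) auto
  moreover have "(e - t) ^ 3 / 27 - (s - t) ^ 3 / 3 = (e - s) ^ 3 / 12"
    unfolding t_def by (simp add: field_simps power3_eq_cube)
  ultimately show ?thesis
    by simp
qed

lemma integral_sq_dist2_ge_remote_right:
  assumes "s \<le> e" "e + (e - s) / 2 \<le> v"
  shows "(e - s) ^ 3 / 12 \<le> integral {s..e} (sq_dist2 u v)"
proof -
  have "sq_dist2 (- v) (- u) = (\<lambda>x. sq_dist2 u v (- x))"
    using sq_dist2_reflect[of v u "- x" for x] by (simp add: fun_eq_iff sq_dist2_commute[of u v])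
  then have "integral {- e..- s} (sq_dist2 (- v) (- u)) = integral {s..e} (sq_dist2 u v)"
    using integral_reflect_real[where f = "sq_dist2 u v" and a = s and b = e] by simp
  then show ?thesis
    using integral_sq_dist2_ge_remote_left[of "- e" "- s" "- v" "- u"] assms by simp
qed

section \<open>The explicit pair and its competitors\<close>

text \<open>
  The densities of the mixture on the two supports are \<open>153/700\<close> and \<open>1347/700\<close>.
\<close>

definition pair_cost :: "real \<Rightarrow> real \<Rightarrow> real" where
  "pair_cost u v = 153 / 700 * integral {0..7/15} (sq_dist2 u v) +
     1347 / 700 * integral {8/15..1} (sq_dist2 u v)"

lemma integral_sq_dist2_nonneg: "0 \<le> integral {s..e} (sq_dist2 u v)"
  by (intro Henstock_Kurzweil_Integration.integral_nonneg sq_dist2_integrable sq_dist2_nonneg)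

lemma pair_cost_nonneg: "0 \<le> pair_cost u v"
  by (simp add: pair_cost_def integral_sq_dist2_nonneg)

lemma distortion_eq_pair_cost:
  "distortion (mixture_measure (51/500) (uniform_measure lborel {0..7/15})
     (uniform_measure lborel {8/15..1})) {u, v} = ennreal (pair_cost u v)"
  by (subst distortion_pair) (simp_all add: pair_cost_def)

text \<open>
  The first point approximates the critical point of the cubic bound near \<open>0.4885\<close>; the second is
  then \<open>(2 + u)/3\<close>, which makes the three parts of the interval from \<open>u\<close> to \<open>1\<close> equal.
\<close>

lemma pair_cost_witness: "pair_cost (49/100) (83/100) = 42459953 / 2362500000"
proof -
  have "integral {8/15..1} (sq_dist2 (49/100) (83/100)) =
      integral {8/15..33/50} (sq_dist2 (49/100) (83/100)) + integral {33/50..1} (sq_dist2 (49/100) (83/100))"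
    by (intro integral_sq_dist2_split) auto
  then show ?thesis
    by (simp add: pair_cost_def integral_sq_dist2_left integral_sq_dist2_right integral_sq_dist
        power3_eq_cube)
qed

text \<open>
  The right-hand side is the cubic bound for the whole mixture; \<open>343/40500\<close> is \<open>L\<^sup>3/12\<close> for
  \<open>L = 7/15\<close>. The difference of the two sides is \<open>(u - 49/100) Q\<close> with a quadratic \<open>Q\<close>. Its roots are near
  \<open>0.27\<close> and \<open>0.487\<close>, so it is negative on \<open>[3/10, 7/15]\<close> and positive from \<open>8/15\<close> on.
\<close>

lemma cubic_bound_off_gap:
  fixes u :: real
  assumes "3/10 \<le> u" "u \<le> 7/15 \<or> 8/15 \<le> u"
  shows "42459953 / 2362500000 <
    153 / 700 * (343/40500 + 7/15 * (7/30 - u)\<^sup>2) +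
    1347 / 700 * ((1 - u) ^ 3 / 27 - (8/15 - u) ^ 3 / 3)"
proof -
  define Q where "Q = 898/1575 * u\<^sup>2 - 33949/78750 * u + 588299/7875000"
  have "0 < (u - 49/100) * Q"
    using assms(2)
  proof
    assume "u \<le> 7/15"
    \<comment> \<open>bound the square by its chord on \<open>[3/10, 7/15]\<close>, which makes the claim linear\<close>
    then have "(u - 3/10) * (u - 7/15) \<le> 0"
      using assms by (intro mult_nonneg_nonpos) auto
    then have "u\<^sup>2 \<le> 23/30 * u - 7/50"
      by (simp add: algebra_simps power2_eq_square)
    then have "Q < 0"
      unfolding Q_def using assms \<open>u \<le> 7/15\<close> by linarith
    then show ?thesis
      using \<open>u \<le> 7/15\<close> by (intro mult_neg_neg) auto
  next
    assume "8/15 \<le> u"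
    \<comment> \<open>bound the square by its tangent at \<open>8/15\<close>\<close>
    have "0 \<le> (u - 8/15)\<^sup>2"
      by simp
    then have "16/15 * u - 64/225 \<le> u\<^sup>2"
      by (simp add: algebra_simps power2_eq_square)
    then have "0 < Q"
      unfolding Q_def using \<open>8/15 \<le> u\<close> by linarith
    then show ?thesis
      using \<open>8/15 \<le> u\<close> by (intro mult_pos_pos) auto
  qed
  also have "(u - 49/100) * Q =
      153 / 700 * (343/40500 + 7/15 * (7/30 - u)\<^sup>2) +
      1347 / 700 * ((1 - u) ^ 3 / 27 - (8/15 - u) ^ 3 / 3) - 42459953 / 2362500000"
    unfolding Q_def by (simp add: field_simps power2_eq_square power3_eq_cube)
  finally show ?thesis
    by simp
qed

lemma pair_cost_off_gap:
  assumes "u \<le> v" "u \<notin> {7/15<..<8/15}"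
  shows "42459953 / 2362500000 < pair_cost u v"
proof -
  let ?I1 = "integral {0..7/15} (sq_dist2 u v)"
  let ?I2 = "integral {8/15..1} (sq_dist2 u v)"
  have "0 \<le> ?I1" "0 \<le> ?I2"
    by (rule integral_sq_dist2_nonneg)+
  note cost = pair_cost_def[of u v]
  show ?thesis
  proof (cases "(u + v) / 2 \<le> 7/15")
    case True
    then have I2: "?I2 = 343/40500 + 7/15 * (23/30 - v)\<^sup>2"
      using \<open>u \<le> v\<close> by (simp add: integral_sq_dist2_right integral_sq_dist_variance power3_eq_cube)
    show ?thesis
    proof (cases "v \<le> 7/10")
      case True
      then have "(1/15)\<^sup>2 \<le> (23/30 - v)\<^sup>2"
        by (intro power_mono) auto
      then have "1/225 \<le> (23/30 - v)\<^sup>2"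
        by (simp add: power_divide)
      then show ?thesis
        using I2 \<open>0 \<le> ?I1\<close> unfolding cost by linarith
    next
      case False
      then have "343/40500 \<le> ?I1"
        using integral_sq_dist2_ge_remote_right[of 0 "7/15" v u] by (simp add: power3_eq_cube)
      moreover have "343/40500 \<le> ?I2"
        unfolding I2 by simp
      ultimately show ?thesis
        unfolding cost by linarith
    qed
  next
    case False
    then have I1: "?I1 = 343/40500 + 7/15 * (7/30 - u)\<^sup>2"
      using \<open>u \<le> v\<close> by (simp add: integral_sq_dist2_left integral_sq_dist_variance power3_eq_cube)
    consider "u \<le> 3/10" | "3/10 \<le> u" "u \<le> 1" | "1 \<le> u"
      by linarith
    then show ?thesis
    proof cases
      case 1
      then have "343/40500 \<le> ?I2"
        using integral_sq_dist2_ge_remote_left[of "8/15" 1 u v] by (simp add: power3_eq_cube)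
      moreover have "343/40500 \<le> ?I1"
        unfolding I1 by simp
      ultimately show ?thesis
        unfolding cost by linarith
    next
      case 2
      then have "1347 / 700 * ((1 - u) ^ 3 / 27 - (8/15 - u) ^ 3 / 3) \<le> 1347 / 700 * ?I2"
        using \<open>u \<le> v\<close> by (intro mult_left_mono integral_sq_dist2_ge_cubic) auto
      moreover have "42459953 / 2362500000 <
          153 / 700 * (343/40500 + 7/15 * (7/30 - u)\<^sup>2) +
          1347 / 700 * ((1 - u) ^ 3 / 27 - (8/15 - u) ^ 3 / 3)"
        using 2 assms(2) by (intro cubic_bound_off_gap) auto
      ultimately show ?thesis
        unfolding cost I1 by (meson add_left_mono less_le_trans)
    next
      case 3
      then have "(23/30)\<^sup>2 \<le> (u - 7/30)\<^sup>2"
        by (intro power_mono) auto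
      then have "529/900 \<le> (7/30 - u)\<^sup>2"
        by (simp add: power2_commute power_divide)
      then show ?thesis
        using I1 \<open>0 \<le> ?I2\<close> unfolding cost by linarith
    qed
  qed
qed

lemma card_le_2_pair:
  fixes A :: "'a::linorder set"
  assumes "1 \<le> card A" "card A \<le> 2"
  obtains u v where "A = {u, v}" "u \<le> v"
proof -
  consider "card A = 1" | "card A = 2"
    using assms by linarith
  then have "\<exists>u v. A = {u, v}"
    by cases (auto simp: card_1_singleton_iff card_2_iff)
  then show thesis
    using that by (metis insert_commute linear)
qed

theorem proposition3p11p1:
  fixes a b c d p :: real
    and P\<^sub>1 P\<^sub>2 P :: "real measure"
    and \<alpha> :: "real set"
  assumes "a = 0" and "b = 7 / 15" and "c = 8 / 15" and "d = 1" and "p = 51 / 500"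
    and "P\<^sub>1 = uniform_measure lborel {a..b}"
    and "P\<^sub>2 = uniform_measure lborel {c..d}"
    and "P = mixture_measure p P\<^sub>1 P\<^sub>2"
    and "optimal_n_means 2 P \<alpha>"
  shows "\<exists>x\<in>\<alpha>. x \<in> {b<..<c}"
proof (rule ccontr)
  assume off_gap: "\<not> ?thesis"
  have P: "distortion P {u, v} = ennreal (pair_cost u v)" for u v
    unfolding assms(8,7,6) assms(1-5) by (rule distortion_eq_pair_cost)
  have \<alpha>: "1 \<le> card \<alpha>" "card \<alpha> \<le> 2" "distortion P \<alpha> = quantization_error 2 P"
    using assms(9) by (auto simp: optimal_n_means_def)
  obtain u v where uv: "\<alpha> = {u, v}" "u \<le> v"
    using \<alpha>(1,2) by (rule card_le_2_pair)
  have "distortion P \<alpha> \<le> distortion P {49/100, 83/100}"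
    unfolding \<alpha>(3) quantization_error_def by (intro INF_lower) auto
  then have "pair_cost u v \<le> pair_cost (49/100) (83/100)"
    unfolding uv(1) P by (simp add: ennreal_le_iff pair_cost_nonneg)
  moreover have "pair_cost (49/100) (83/100) < pair_cost u v"
    unfolding pair_cost_witness using uv off_gap assms(2,3) by (intro pair_cost_off_gap) auto
  ultimately show False
    by simp
qed

end
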